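(* If $R$ is a weakly locally finite profinite ring, then its Jacobson radical $J(R)$ is nil of finite nilexponent. More generally, each nil profinite ring has finite nilexponent.
   Context: Rings are associative, not necessarily commutative and not necessarily unital. A profinite ring is the limit of an inverse system of finite rings, viewed as a (Hausdorff) topological ring with the limit topology. A ring is weakly locally finite if each of its subrings generated by one element is finite (subrings need not contain a unit). The Jacobson radical is $J(R)=\{x\in R : \forall y\in R\ \exists z\in R\ (yx+z+zyx=0)\}$. A ring is nil if each of its elements $r$ is nilpotent, i.e. $r^n=0$ for some $n\ge 1$; it is nil of finite nilexponent if there is a single $n\geq 1$ such that $r^n=0$ for all elements $r$ (the least such $n$ is the nilexponent). *)

theory Defs
  imports "HOL-Analysis.Analysis" "HOL-Algebra.Ring"
begin

text \<open>
  Rings here are associative, but need be neither commutative nor unital. We use the ring records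
  of HOL-Algebra and ignore their field \<open>one\<close> throughout; in particular subrings,
  homomorphisms and powers must not refer to it, so the unital library notions do not apply.
\<close>

locale rng = abelian_group R for R (structure) +
  assumes m_closed: "\<lbrakk>x \<in> carrier R; y \<in> carrier R\<rbrakk> \<Longrightarrow> x \<otimes> y \<in> carrier R"
    and m_assoc: "\<lbrakk>x \<in> carrier R; y \<in> carrier R; z \<in> carrier R\<rbrakk>
      \<Longrightarrow> (x \<otimes> y) \<otimes> z = x \<otimes> (y \<otimes> z)"
    and l_distr: "\<lbrakk>x \<in> carrier R; y \<in> carrier R; z \<in> carrier R\<rbrakk>
      \<Longrightarrow> (x \<oplus> y) \<otimes> z = x \<otimes> z \<oplus> y \<otimes> z"
    and r_distr: "\<lbrakk>x \<in> carrier R; y \<in> carrier R; z \<in> carrier R\<rbrakk>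
      \<Longrightarrow> z \<otimes> (x \<oplus> y) = z \<otimes> x \<oplus> z \<otimes> y"

definition rng_hom :: "('a, 'm) ring_scheme \<Rightarrow> ('b, 'n) ring_scheme \<Rightarrow> ('a \<Rightarrow> 'b) set"
  where "rng_hom R S = hom (add_monoid R) (add_monoid S) \<inter> hom R S"

definition subrng :: "'a set \<Rightarrow> ('a, 'm) ring_scheme \<Rightarrow> bool"
  where "subrng H R \<longleftrightarrow>
    subgroup H (add_monoid R) \<and> (\<forall>x\<in>H. \<forall>y\<in>H. x \<otimes>\<^bsub>R\<^esub> y \<in> H)"

definition generated_subrng :: "('a, 'm) ring_scheme \<Rightarrow> 'a \<Rightarrow> 'a set"
  where "generated_subrng R x = \<Inter> {H. subrng H R \<and> x \<in> H}"

definition weakly_locally_finite :: "('a, 'm) ring_scheme \<Rightarrow> bool"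
  where "weakly_locally_finite R \<longleftrightarrow> (\<forall>x\<in>carrier R. finite (generated_subrng R x))"

text \<open>The power \<open>x\<^sup>n\<close>, meaningful only for \<open>n \<ge> 1\<close>.\<close>

definition rng_pow :: "('a, 'm) ring_scheme \<Rightarrow> 'a \<Rightarrow> nat \<Rightarrow> 'a"
  where "rng_pow R x n = ((\<lambda>y. y \<otimes>\<^bsub>R\<^esub> x) ^^ (n - 1)) x"

definition nil_rng :: "('a, 'm) ring_scheme \<Rightarrow> bool"
  where "nil_rng R \<longleftrightarrow> (\<forall>x\<in>carrier R. \<exists>n\<ge>1. rng_pow R x n = \<zero>\<^bsub>R\<^esub>)"

definition nil_of_finite_nilexponent :: "('a, 'm) ring_scheme \<Rightarrow> bool"
  where "nil_of_finite_nilexponent R \<longleftrightarrow>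
    (\<exists>n\<ge>1. \<forall>x\<in>carrier R. rng_pow R x n = \<zero>\<^bsub>R\<^esub>)"

definition jacobson_radical :: "('a, 'm) ring_scheme \<Rightarrow> 'a set"
  where "jacobson_radical R = {x \<in> carrier R. \<forall>y\<in>carrier R. \<exists>z\<in>carrier R.
    y \<otimes>\<^bsub>R\<^esub> x \<oplus>\<^bsub>R\<^esub> z \<oplus>\<^bsub>R\<^esub> z \<otimes>\<^bsub>R\<^esub> y \<otimes>\<^bsub>R\<^esub> x = \<zero>\<^bsub>R\<^esub>}"

text \<open>
  The index set \<open>I\<close> is directed by \<open>r\<close>, and \<open>(i, j) \<in> r\<close> means \<open>i \<le> j\<close>. The transition map
  \<open>\<phi> i j\<close> then goes from \<open>S j\<close> to \<open>S i\<close>. A common element type for all \<open>S i\<close> loses no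
  generality, since they are finite.
\<close>

locale inverse_system_of_finite_rngs =
  fixes I :: "'i set" and r :: "'i rel" and S :: "'i \<Rightarrow> 'b ring"
    and \<phi> :: "'i \<Rightarrow> 'i \<Rightarrow> 'b \<Rightarrow> 'b"
  assumes partial_order: "partial_order_on I r"
    and nonempty: "I \<noteq> {}"
    and directed: "\<lbrakk>i \<in> I; j \<in> I\<rbrakk> \<Longrightarrow> \<exists>k\<in>I. (i, k) \<in> r \<and> (j, k) \<in> r"
    and rng: "i \<in> I \<Longrightarrow> rng (S i)"
    and finite: "i \<in> I \<Longrightarrow> finite (carrier (S i))"
    and hom: "(i, j) \<in> r \<Longrightarrow> \<phi> i j \<in> rng_hom (S j) (S i)"
    and id: "\<lbrakk>i \<in> I; x \<in> carrier (S i)\<rbrakk> \<Longrightarrow> \<phi> i i x = x"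
    and comp: "\<lbrakk>(i, j) \<in> r; (j, k) \<in> r; x \<in> carrier (S k)\<rbrakk> \<Longrightarrow> \<phi> i j (\<phi> j k x) = \<phi> i k x"

definition inverse_limit ::
    "'i set \<Rightarrow> 'i rel \<Rightarrow> ('i \<Rightarrow> 'b ring) \<Rightarrow> ('i \<Rightarrow> 'i \<Rightarrow> 'b \<Rightarrow> 'b) \<Rightarrow> ('i \<Rightarrow> 'b) ring"
  where "inverse_limit I r S \<phi> =
    \<lparr>carrier = {x \<in> \<Pi>\<^sub>E i\<in>I. carrier (S i). \<forall>(i, j)\<in>r. \<phi> i j (x j) = x i},
     mult = (\<lambda>x y. \<lambda>i\<in>I. x i \<otimes>\<^bsub>S i\<^esub> y i),
     one = (\<lambda>i\<in>I. \<one>\<^bsub>S i\<^esub>),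
     zero = (\<lambda>i\<in>I. \<zero>\<^bsub>S i\<^esub>),
     add = (\<lambda>x y. \<lambda>i\<in>I. x i \<oplus>\<^bsub>S i\<^esub> y i)\<rparr>"

definition inverse_limit_topology ::
    "'i set \<Rightarrow> 'i rel \<Rightarrow> ('i \<Rightarrow> 'b ring) \<Rightarrow> ('i \<Rightarrow> 'i \<Rightarrow> 'b \<Rightarrow> 'b) \<Rightarrow> ('i \<Rightarrow> 'b) topology"
  where "inverse_limit_topology I r S \<phi> =
    subtopology (product_topology (\<lambda>i. discrete_topology (carrier (S i))) I)
      (carrier (inverse_limit I r S \<phi>))"

text \<open>
  A ring \<open>R\<close> with topology \<open>T\<close> on its carrier is profinite if it is isomorphic, as a topological
  ring, to the limit of an inverse system of finite rings. Definitions cannot quantify over types,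
  so the types of the indices and of the elements of the finite rings are parameters; a theorem
  that leaves them arbitrary covers all profinite rings.
\<close>

definition profinite_rng ::
    "'i itself \<Rightarrow> 'b itself \<Rightarrow> ('a, 'm) ring_scheme \<Rightarrow> 'a topology \<Rightarrow> bool"
  where "profinite_rng index_type element_type R T \<longleftrightarrow>
    rng R \<and> topspace T = carrier R \<and>
    (\<exists>(I :: 'i set) r (S :: 'i \<Rightarrow> 'b ring) \<phi> h.
      inverse_system_of_finite_rngs I r S \<phi> \<and>
      h \<in> rng_hom R (inverse_limit I r S \<phi>) \<and>
      homeomorphic_map T (inverse_limit_topology I r S \<phi>) h)"

end

theory Submission
  imports Defs
begin

text \<open>
  By a Baire category argument, a compact nil ring contains a coset \<open>a + I\<close> of an open ideal on which
  \<open>x\<^sup>n = 0\<close> for one \<open>n\<close>. This already makes \<open>I\<close> nil: if \<open>y \<in> I\<close> were not nilpotent, some prime ideal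
  \<open>P\<close> would contain no power of \<open>y\<close>. If \<open>b = a\<^sup>k\<close> and \<open>a\<^sup>k\<^sup>+\<^sup>1 \<in> P\<close>, then \<open>b (a + y b)\<^sup>n\<close> is congruent to
  \<open>(b y)\<^sup>n b\<close> modulo \<open>P\<close>, so \<open>b I\<close> is nil of bounded index modulo \<open>P\<close>, and Levitzki's theorem gives
  \<open>b \<in> P\<close>. Descending in \<open>k\<close>, one finds \<open>a \<in> P\<close>, whence \<open>y\<^sup>n \<in> P\<close>, a contradiction. The same applied to
  sequences of elements bounds the index of \<open>I\<close>, hence that of the ring, as its quotient by \<open>I\<close> is
  finite. In a weakly locally finite ring the Jacobson radical contains no nonzero idempotent, so it
  is nil, and in the profinite case it is also compact.
\<close>

subsection \<open>Rings without unit and their prime ideals\<close>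

context rng
begin

declare m_closed [simp, intro]

lemma rng_l_null [simp]:
  assumes "x \<in> carrier R" shows "\<zero> \<otimes> x = \<zero>"
proof -
  have "\<zero> \<otimes> x \<oplus> \<zero> \<otimes> x = \<zero> \<otimes> x \<oplus> \<zero>"
    using assms l_distr[of \<zero> \<zero> x] by simp
  then show ?thesis using assms by (simp del: r_zero)
qed

lemma rng_r_null [simp]:
  assumes "x \<in> carrier R" shows "x \<otimes> \<zero> = \<zero>"
proof -
  have "x \<otimes> \<zero> \<oplus> x \<otimes> \<zero> = x \<otimes> \<zero> \<oplus> \<zero>"
    using assms r_distr[of \<zero> \<zero> x] by simp
  then show ?thesis using assms by (simp del: r_zero)
qed

lemma rng_l_minus:
  assumes "x \<in> carrier R" "y \<in> carrier R" shows "(\<ominus> x) \<otimes> y = \<ominus> (x \<otimes> y)"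
proof -
  have "(\<ominus> x) \<otimes> y \<oplus> x \<otimes> y = \<zero>"
    using assms l_distr[of "\<ominus> x" x y] by (simp add: l_neg)
  then show ?thesis using assms by (simp add: add.inv_equality)
qed

lemma rng_r_minus:
  assumes "x \<in> carrier R" "y \<in> carrier R" shows "x \<otimes> (\<ominus> y) = \<ominus> (x \<otimes> y)"
proof -
  have "x \<otimes> (\<ominus> y) \<oplus> x \<otimes> y = \<zero>"
    using assms r_distr[of "\<ominus> y" y x] by (simp add: l_neg)
  then show ?thesis using assms by (simp add: add.inv_equality)
qed

lemma rng_pow_1 [simp]: "rng_pow R x (Suc 0) = x"
  by (simp add: rng_pow_def)

lemma rng_pow_Suc: "1 \<le> n \<Longrightarrow> rng_pow R x (Suc n) = rng_pow R x n \<otimes> x"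
  by (cases n) (simp_all add: rng_pow_def)

lemma rng_pow_closed [simp, intro]: "x \<in> carrier R \<Longrightarrow> rng_pow R x n \<in> carrier R"
proof (induction n)
  case 0 then show ?case by (simp add: rng_pow_def)
next
  case (Suc n) then show ?case
    by (cases "n = 0") (auto simp: rng_pow_Suc)
qed

lemma rng_pow_add:
  assumes "x \<in> carrier R" "1 \<le> m" "1 \<le> n"
  shows "rng_pow R x m \<otimes> rng_pow R x n = rng_pow R x (m + n)"
  using assms(3)
proof (induction n rule: dec_induct)
  case base
  show ?case using assms by (simp add: rng_pow_Suc)
next
  case (step n)
  then show ?case using assms by (simp add: rng_pow_Suc flip: m_assoc)
qed

lemma rng_pow_mult:
  assumes "x \<in> carrier R" "1 \<le> m" "1 \<le> n"
  shows "rng_pow R (rng_pow R x m) n = rng_pow R x (m * n)"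
  using assms(3)
proof (induction n rule: dec_induct)
  case base
  show ?case by simp
next
  case (step n)
  then show ?case using assms by (simp add: rng_pow_Suc rng_pow_add add.commute)
qed

lemma rng_pow_zero_mono:
  assumes "x \<in> carrier R" "rng_pow R x m = \<zero>" "1 \<le> m" "m \<le> n"
  shows "rng_pow R x n = \<zero>"
  using assms(4) by (induction n rule: dec_induct) (use assms in \<open>simp_all add: rng_pow_Suc\<close>)

section \<open>Two-sided ideals and prime ideals\<close>

text \<open>Closure under negation is listed separately: without a unit it does not follow from the
  absorption of products.\<close>

definition rng_ideal :: "'a set \<Rightarrow> bool"
  where "rng_ideal P \<longleftrightarrow> P \<subseteq> carrier R \<and> \<zero> \<in> P \<and> (\<forall>x\<in>P. \<ominus> x \<in> P) \<and>
    (\<forall>x\<in>P. \<forall>y\<in>P. x \<oplus> y \<in> P) \<and> (\<forall>x\<in>P. \<forall>r\<in>carrier R. r \<otimes> x \<in> P \<and> x \<otimes> r \<in> P)"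

text \<open>Noncommutative primeness, phrased with elements. The whole ring counts as prime; it is
  excluded later by requiring that \<open>P\<close> omit some power or fail to contain a given
  ideal.\<close>

definition rng_prime :: "'a set \<Rightarrow> bool"
  where "rng_prime P \<longleftrightarrow> rng_ideal P \<and> (\<forall>x\<in>carrier R. \<forall>z\<in>carrier R.
    (\<forall>r\<in>carrier R. x \<otimes> r \<otimes> z \<in> P) \<longrightarrow> x \<in> P \<or> z \<in> P)"

lemma rng_idealD:
  assumes "rng_ideal P"
  shows "x \<in> P \<Longrightarrow> x \<in> carrier R" "\<zero> \<in> P" "x \<in> P \<Longrightarrow> y \<in> P \<Longrightarrow> x \<oplus> y \<in> P"
    "x \<in> P \<Longrightarrow> r \<in> carrier R \<Longrightarrow> r \<otimes> x \<in> P" "x \<in> P \<Longrightarrow> r \<in> carrier R \<Longrightarrow> x \<otimes> r \<in> P"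
  using assms unfolding rng_ideal_def by auto

text \<open>This replaces computing in the quotient by \<open>P\<close>: summands from
  \<open>P\<close> may be dropped when testing membership.\<close>

lemma rng_ideal_add_cancel:
  assumes "rng_ideal P" "x \<in> carrier R" "p \<in> P"
  shows "x \<oplus> p \<in> P \<longleftrightarrow> x \<in> P"
proof
  have p: "p \<in> carrier R" "\<ominus> p \<in> P" using assms unfolding rng_ideal_def by auto
  assume "x \<oplus> p \<in> P"
  then have "(x \<oplus> p) \<oplus> \<ominus> p \<in> P" using rng_idealD[OF assms(1)] p by blast
  moreover have "(x \<oplus> p) \<oplus> \<ominus> p = x" using assms(2) p by (simp add: a_assoc r_neg)
  ultimately show "x \<in> P" by simp
qed (use assms rng_idealD in auto)

text \<open>
  Primality of an ideal \<open>P\<close> that is maximal among those avoiding the powers of \<open>y\<close>: if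
  \<open>x R z \<subseteq> P\<close>, the transporters \<open>{u. u R z \<subseteq> P}\<close> and \<open>{v. y\<^sup>i R v \<subseteq> P}\<close> serve in place of the ideals
  generated by \<open>P\<close> and one element, which are awkward without a unit.
\<close>

lemma rng_prime_exists:
  assumes y: "y \<in> carrier R" and nonnil: "\<And>n. 1 \<le> n \<Longrightarrow> rng_pow R y n \<noteq> \<zero>"
  obtains P where "rng_prime P" "\<And>n. 1 \<le> n \<Longrightarrow> rng_pow R y n \<notin> P"
proof -
  let ?A = "{P. rng_ideal P \<and> (\<forall>n\<ge>1. rng_pow R y n \<notin> P)}"
  have "{\<zero>} \<in> ?A" using nonnil by (auto simp: rng_ideal_def)
  then have "?A \<noteq> {}" by (metis empty_iff)
  moreover have "\<Union>C \<in> ?A" if C: "C \<noteq> {}" "subset.chain ?A C" for C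
  proof -
    have CA: "\<And>X. X \<in> C \<Longrightarrow> X \<in> ?A" using C by (auto simp: subset_chain_def)
    have dir: "x \<oplus> z \<in> \<Union>C" if "X \<in> C" "x \<in> X" "Z \<in> C" "z \<in> Z" for x z X Z
    proof -
      have "X \<subseteq> Z \<or> Z \<subseteq> X" using C that by (auto simp: subset_chain_def)
      then show ?thesis using CA that rng_idealD(3) by blast
    qed
    have mem: "\<ominus> x \<in> X" "x \<in> carrier R"
        "r \<in> carrier R \<Longrightarrow> r \<otimes> x \<in> X" "r \<in> carrier R \<Longrightarrow> x \<otimes> r \<in> X"
      if "X \<in> C" "x \<in> X" for x X r
      using CA[OF that(1)] that(2) unfolding rng_ideal_def by auto
    have "\<zero> \<in> \<Union>C" using C(1) CA rng_idealD(2) by blast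
    then have "rng_ideal (\<Union>C)"
      unfolding rng_ideal_def
    proof (intro conjI subsetI ballI)
      fix x assume "x \<in> \<Union>C"
      then obtain X where X: "X \<in> C" "x \<in> X" by blast
      show "x \<in> carrier R" "\<ominus> x \<in> \<Union>C" using mem[OF X] X by auto
      show "x \<oplus> z \<in> \<Union>C" if "z \<in> \<Union>C" for z using dir[OF X] that by blast
      show "r \<otimes> x \<in> \<Union>C" "x \<otimes> r \<in> \<Union>C" if "r \<in> carrier R" for r
        using mem(3,4)[OF X that] X by auto
    qed
    then show ?thesis using CA by blast
  qed
  ultimately have "\<exists>P\<in>?A. \<forall>X\<in>?A. P \<subseteq> X \<longrightarrow> X = P"
    by (rule subset_Zorn_nonempty)
  then obtain P where P: "rng_ideal P" and avoid: "\<And>n. 1 \<le> n \<Longrightarrow> rng_pow R y n \<notin> P"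
    and max': "\<forall>X\<in>?A. P \<subseteq> X \<longrightarrow> X = P"
    by blast
  have max: "\<exists>n\<ge>1. rng_pow R y n \<in> X" if "rng_ideal X" "P \<subseteq> X" "X \<noteq> P" for X
    using max' that by blast
  note PD = rng_idealD[OF P]
  have Pm: "\<And>x. x \<in> P \<Longrightarrow> \<ominus> x \<in> P" using P by (auto simp: rng_ideal_def)
  have "x \<in> P \<or> z \<in> P"
    if xz: "x \<in> carrier R" "z \<in> carrier R" "\<forall>r\<in>carrier R. x \<otimes> r \<otimes> z \<in> P" for x z
  proof (rule ccontr)
    assume no: "\<not> (x \<in> P \<or> z \<in> P)"
    let ?Q = "{u \<in> carrier R. \<forall>r\<in>carrier R. u \<otimes> r \<otimes> z \<in> P}"
    have "u \<otimes> r \<otimes> s \<otimes> z \<in> P" if "u \<in> ?Q" "r \<in> carrier R" "s \<in> carrier R" for u r s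
    proof -
      have "u \<otimes> (r \<otimes> s) \<otimes> z \<in> P" using that by auto
      then show ?thesis using that xz by (simp add: m_assoc)
    qed
    moreover have "r \<otimes> u \<otimes> s \<otimes> z \<in> P" if "u \<in> ?Q" "r \<in> carrier R" "s \<in> carrier R" for u r s
      using that PD(4)[of "u \<otimes> s \<otimes> z" r] xz by (auto simp: m_assoc)
    ultimately have "rng_ideal ?Q"
      unfolding rng_ideal_def using xz PD(2,3) Pm
      by (auto simp: l_distr rng_l_minus)
    moreover have "P \<subseteq> ?Q" using PD xz by auto
    moreover have "?Q \<noteq> P" using xz no by blast
    \<comment> \<open>\<open>x\<close> lies in \<open>?Q\<close> but not in \<open>P\<close>, so
      maximality of \<open>P\<close> puts a power of \<open>y\<close> into
      \<open>?Q\<close>.\<close>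
    ultimately obtain i where i: "1 \<le> i" "rng_pow R y i \<in> ?Q" using max by blast
    let ?Q' = "{v \<in> carrier R. \<forall>r\<in>carrier R. rng_pow R y i \<otimes> r \<otimes> v \<in> P}"
    let ?e = "rng_pow R y i"
    have "?e \<otimes> s \<otimes> (r \<otimes> v) \<in> P" if "v \<in> ?Q'" "r \<in> carrier R" "s \<in> carrier R" for v r s
    proof -
      have "?e \<otimes> (s \<otimes> r) \<otimes> v \<in> P" using that by auto
      then show ?thesis using that y by (simp add: m_assoc)
    qed
    moreover have "?e \<otimes> s \<otimes> (v \<otimes> r) \<in> P" if "v \<in> ?Q'" "r \<in> carrier R" "s \<in> carrier R" for v r s
      using that PD(5)[of "?e \<otimes> s \<otimes> v" r] y by (auto simp: m_assoc)
    ultimately have "rng_ideal ?Q'"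
      unfolding rng_ideal_def using y PD(2,3) Pm
      by (auto simp: r_distr rng_r_minus)
    moreover have "P \<subseteq> ?Q'" using PD y by auto
    moreover have "?Q' \<noteq> P" using xz no i by blast
    ultimately obtain j where j: "1 \<le> j" "rng_pow R y j \<in> ?Q'" using max by blast
    \<comment> \<open>Taking the middle factor to be \<open>y\<close> itself produces a genuine
      power of \<open>y\<close> in \<open>P\<close>.\<close>
    then have "rng_pow R y i \<otimes> y \<otimes> rng_pow R y j \<in> P" using y by auto
    moreover have "rng_pow R y i \<otimes> y \<otimes> rng_pow R y j = rng_pow R y (Suc i + j)"
      using i j y by (subst rng_pow_add[symmetric]) (auto simp: rng_pow_Suc)
    ultimately show False using avoid[of "Suc i + j"] by simp
  qed
  then have "rng_prime P" using P unfolding rng_prime_def by blast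
  then show thesis using avoid that by blast
qed

subsection \<open>Nil cosets of ideals\<close>

text \<open>\<open>(u x)\<^sup>n u\<close>, which makes sense for \<open>n = 0\<close> also without a unit.\<close>

definition sandwich_pow :: "'a \<Rightarrow> 'a \<Rightarrow> nat \<Rightarrow> 'a"
  where "sandwich_pow u x n = ((\<lambda>q. q \<otimes> x \<otimes> u) ^^ n) u"

lemma sandwich_pow_simps [simp]:
  "sandwich_pow u x 0 = u"
  "sandwich_pow u x (Suc n) = sandwich_pow u x n \<otimes> x \<otimes> u"
  by (simp_all add: sandwich_pow_def)

lemma sandwich_pow_closed [simp, intro]:
  "u \<in> carrier R \<Longrightarrow> x \<in> carrier R \<Longrightarrow> sandwich_pow u x n \<in> carrier R"
  by (induction n) auto

lemma sandwich_pow_ideal_mono: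
  assumes "rng_ideal P" "u \<in> carrier R" "x \<in> carrier R" "sandwich_pow u x m \<in> P" "m \<le> n"
  shows "sandwich_pow u x n \<in> P"
  using assms(5) by (induction n rule: dec_induct) (use assms rng_idealD in auto)

text \<open>Take \<open>w = x (u x)^k\<close>: it lies in \<open>I\<close> and does not depend on
  \<open>i\<close>, so a single \<open>w\<close> serves all exponents.\<close>

lemma sandwich_pow_eq_sandwich:
  assumes "rng_ideal I" "u \<in> carrier R" "x \<in> I"
  shows "\<exists>w\<in>I. \<forall>i. sandwich_pow u x i \<otimes> w \<otimes> u = sandwich_pow u x (i + Suc k)"
proof (induction k)
  case 0
  then show ?case using assms by (intro bexI[of _ x]) auto
next
  case (Suc k)
  note ID = rng_idealD[OF assms(1)]
  from Suc obtain w where w: "w \<in> I"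
    and eq: "\<And>i. sandwich_pow u x i \<otimes> w \<otimes> u = sandwich_pow u x (i + Suc k)" by blast
  have c: "x \<in> carrier R" "w \<in> carrier R" using ID assms w by auto
  have "sandwich_pow u x i \<otimes> (w \<otimes> u \<otimes> x) \<otimes> u = sandwich_pow u x (i + Suc (Suc k))" for i
  proof -
    have "sandwich_pow u x i \<otimes> (w \<otimes> u \<otimes> x) \<otimes> u = (sandwich_pow u x i \<otimes> w \<otimes> u) \<otimes> x \<otimes> u"
      using c assms by (simp add: m_assoc)
    then show ?thesis by (simp only: eq add_Suc_right sandwich_pow_simps)
  qed
  moreover have "w \<otimes> u \<otimes> x \<in> I" using ID w c assms by auto
  ultimately show ?case by blast
qed

text \<open>With \<open>x = w u s\<close> one has \<open>u x = v s\<close>. Expand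
  \<open>(u w + v s)^(j+1) u\<close> into words: a factor \<open>u w\<close> that is not the last
  one meets \<open>u w u\<close> or \<open>v s = u w u s\<close> and creates \<open>v w u\<close>,
  which lies in \<open>P\<close>. Only the words with \<open>u w\<close> in last place or nowhere
  survive.\<close>

lemma sandwich_pow_add_mod:
  assumes P: "rng_ideal P"
    and c: "u \<in> carrier R" "w \<in> carrier R" "s \<in> carrier R"
    and v: "v = u \<otimes> w \<otimes> u" and vwu: "v \<otimes> w \<otimes> u \<in> P"
  shows "\<exists>p\<in>P. sandwich_pow u (w \<oplus> w \<otimes> u \<otimes> s) (Suc j) =
    sandwich_pow v s j \<oplus> sandwich_pow u (w \<otimes> u \<otimes> s) (Suc j) \<oplus> p"
proof -
  note PD = rng_idealD[OF P]
  define x where "x = w \<otimes> u \<otimes> s"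
  have cx: "x \<in> carrier R" "v \<in> carrier R" using c v by (auto simp: x_def)
  have A: "sandwich_pow u x i \<otimes> w \<otimes> u = sandwich_pow v s i" for i
  proof (induction i)
    case (Suc i)
    have "sandwich_pow u x (Suc i) \<otimes> w \<otimes> u = (sandwich_pow u x i \<otimes> w \<otimes> u) \<otimes> s \<otimes> (u \<otimes> w \<otimes> u)"
      using c cx by (simp add: m_assoc x_def)
    then show ?case by (simp only: Suc v sandwich_pow_simps)
  qed (simp add: v)
  have B: "sandwich_pow v s i \<otimes> w \<otimes> u \<in> P" for i
  proof (cases i)
    case (Suc i)
    have "sandwich_pow v s (Suc i) \<otimes> w \<otimes> u = (sandwich_pow v s i \<otimes> s) \<otimes> (v \<otimes> w \<otimes> u)"
      using c cx by (simp add: m_assoc)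
    then show ?thesis using PD vwu c cx Suc by simp
  qed (simp add: vwu)
  have C: "sandwich_pow v s i \<otimes> x \<otimes> u \<in> P" for i
  proof -
    have "sandwich_pow v s i \<otimes> x \<otimes> u = (sandwich_pow v s i \<otimes> w \<otimes> u) \<otimes> (s \<otimes> u)"
      using c cx by (simp add: m_assoc x_def)
    then show ?thesis using PD B[of i] c cx by simp
  qed
  have "\<exists>p\<in>P. sandwich_pow u (w \<oplus> x) (Suc j) =
    sandwich_pow v s j \<oplus> sandwich_pow u x (Suc j) \<oplus> p"
  proof (induction j)
    case 0
    have "sandwich_pow u (w \<oplus> x) (Suc 0) = v \<oplus> sandwich_pow u x (Suc 0) \<oplus> \<zero>"
      using c cx by (simp add: v l_distr r_distr)
    then show ?case using PD by (intro bexI[of _ \<zero>]) simp_all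
  next
    case (Suc j)
    let ?h = "sandwich_pow v s j" and ?g = "sandwich_pow u x (Suc j)"
    from Suc obtain p where p: "p \<in> P" "sandwich_pow u (w \<oplus> x) (Suc j) = ?h \<oplus> ?g \<oplus> p" by blast
    have cp: "p \<in> carrier R" "?h \<in> carrier R" "?g \<in> carrier R" using PD p c cx by auto
    let ?p = "?h \<otimes> w \<otimes> u \<oplus> ?h \<otimes> x \<otimes> u \<oplus> p \<otimes> (w \<oplus> x) \<otimes> u"
    have "sandwich_pow u (w \<oplus> x) (Suc (Suc j)) = (?h \<oplus> ?g \<oplus> p) \<otimes> (w \<oplus> x) \<otimes> u"
      by (simp only: sandwich_pow_simps(2)[of _ _ "Suc j"] p)
    also have "\<dots> = ?g \<otimes> w \<otimes> u \<oplus> ?g \<otimes> x \<otimes> u \<oplus> ?p"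
      using cp c cx by (simp del: sandwich_pow_simps add: l_distr r_distr a_ac)
    also have "\<dots> = sandwich_pow v s (Suc j) \<oplus> sandwich_pow u x (Suc (Suc j)) \<oplus> ?p"
      by (simp only: A sandwich_pow_simps(2)[of u x "Suc j"])
    finally show ?case
      using PD B[of j] C[of j] p c cx by (intro bexI[of _ ?p]) auto
  qed
  then show ?thesis unfolding x_def .
qed

text \<open>
  Levitzki's theorem on nil one-sided ideals of bounded index, in the form needed here. The
  induction lowers \<open>m\<close>: for \<open>v = (u x)\<^sup>m\<^sup>-\<^sup>1 u = u w u\<close>, the powers of \<open>u (w + w u s)\<close> simplify because
  \<open>u w u w u \<in> P\<close>.
\<close>

lemma prime_sandwich_pow:
  assumes P: "rng_prime P" and I: "rng_ideal I" and nsub: "\<not> I \<subseteq> P"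
    and "u \<in> carrier R" "\<And>x. x \<in> I \<Longrightarrow> sandwich_pow u x m \<in> P"
  shows "u \<in> P"
  using assms(4,5)
proof (induction m arbitrary: u)
  case 0
  then show ?case using rng_idealD(2)[OF I] by force
next
  case (Suc m)
  have Pi: "rng_ideal P" using P by (simp add: rng_prime_def)
  note PD = rng_idealD[OF Pi] and ID = rng_idealD[OF I]
  have prime: "x \<in> P \<or> z \<in> P"
    if "x \<in> carrier R" "z \<in> carrier R" "\<And>r. r \<in> carrier R \<Longrightarrow> x \<otimes> r \<otimes> z \<in> P" for x z
    using P that unfolding rng_prime_def by blast
  show ?case
  proof (cases m)
    case 0
    obtain c where c: "c \<in> I" "c \<notin> P" "c \<in> carrier R" using nsub ID by blast
    show ?thesis
    proof (rule ccontr)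
      assume u: "u \<notin> P"
      \<comment> \<open>Here \<open>u I u\<close> lies in \<open>P\<close>. Primeness is applied
        first to \<open>u r c\<close> and \<open>u\<close>, then to \<open>u\<close> and
        \<open>c\<close>.\<close>
      have "u \<otimes> r \<otimes> c \<in> P" if r: "r \<in> carrier R" for r
      proof -
        have "u \<otimes> r \<otimes> c \<otimes> s \<otimes> u \<in> P" if s: "s \<in> carrier R" for s
          using Suc.prems(2)[of "r \<otimes> c \<otimes> s"] ID c r s Suc.prems(1) 0 by (simp add: m_assoc)
        then show ?thesis using prime[of "u \<otimes> r \<otimes> c" u] u r c Suc.prems(1) by auto
      qed
      then show False using prime[of u c] u c Suc.prems(1) by auto
    qed
  next
    case (Suc k)
    have "sandwich_pow u x m \<in> P" if x: "x \<in> I" for x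
    proof -
      obtain w where w: "w \<in> I"
        and eq: "\<And>i. sandwich_pow u x i \<otimes> w \<otimes> u = sandwich_pow u x (i + m)"
        using sandwich_pow_eq_sandwich[OF I Suc.prems(1) x, of k] Suc by blast
      have c: "x \<in> carrier R" "w \<in> carrier R" "u \<in> carrier R" using ID x w Suc.prems by auto
      define v where "v = sandwich_pow u x m"
      have v: "v = u \<otimes> w \<otimes> u" using eq[of 0] by (simp add: v_def)
      \<comment> \<open>As \<open>m = Suc k\<close>, the exponent \<open>m + m\<close> is at least
        \<open>Suc m\<close>, so the hypothesis on \<open>u\<close> covers it.\<close>
      have "v \<otimes> w \<otimes> u = sandwich_pow u x (m + m)" using eq[of m] by (simp add: v_def)
      then have vwu: "v \<otimes> w \<otimes> u \<in> P"
        using sandwich_pow_ideal_mono[OF Pi c(3,1) Suc.prems(2)[OF x], of "m + m"] Suc by simp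
      have "sandwich_pow v s m \<in> P" if s: "s \<in> I" for s
      proof -
        have cs: "s \<in> carrier R" using ID s by blast
        obtain p where p: "p \<in> P" and
          e: "sandwich_pow u (w \<oplus> w \<otimes> u \<otimes> s) (Suc m) =
            sandwich_pow v s m \<oplus> sandwich_pow u (w \<otimes> u \<otimes> s) (Suc m) \<oplus> p"
          using sandwich_pow_add_mod[OF Pi c(3,2) cs v vwu, of m] by blast
        have wus: "w \<otimes> u \<otimes> s \<in> I" "w \<oplus> w \<otimes> u \<otimes> s \<in> I" using ID w s c by auto
        have cv: "v \<in> carrier R" using c v by auto
        \<comment> \<open>The whole sum and its middle summand are sandwich powers of
          \<open>u\<close> with exponent \<open>Suc m\<close>, hence in \<open>P\<close>; what
          remains is that of \<open>v\<close>, with exponent only \<open>m\<close>.\<close>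
        have "sandwich_pow v s m \<oplus> sandwich_pow u (w \<otimes> u \<otimes> s) (Suc m) \<oplus> p \<in> P"
          using Suc.prems(2)[OF wus(2)] e by simp
        then show ?thesis
          using Suc.prems(2)[OF wus(1)] p cv cs c ID(1)[OF wus(1)]
          by (simp add: rng_ideal_add_cancel[OF Pi] del: sandwich_pow_simps)
      qed
      \<comment> \<open>The induction hypothesis is used twice: here for \<open>v\<close>, and then,
        since \<open>x\<close> was arbitrary, for \<open>u\<close>.\<close>
      then have "v \<in> P" using Suc.IH[of v] c by (simp add: v_def)
      then show ?thesis by (simp add: v_def)
    qed
    then show ?thesis using Suc.IH Suc.prems by blast
  qed
qed

lemma prime_coset_nil:
  assumes P: "rng_prime P" and I: "rng_ideal I" and nsub: "\<not> I \<subseteq> P"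
    and a: "a \<in> carrier R" and n: "1 \<le> n"
    and nil: "\<And>y. y \<in> I \<Longrightarrow> rng_pow R (a \<oplus> y) n \<in> P"
  shows "a \<in> P"
proof -
  have Pi: "rng_ideal P" using P by (simp add: rng_prime_def)
  note PD = rng_idealD[OF Pi] and ID = rng_idealD[OF I]
  have step: "rng_pow R a k \<in> P" if k: "1 \<le> k" and Suc: "rng_pow R a (Suc k) \<in> P" for k
  proof -
    define b where "b = rng_pow R a k"
    have b: "b \<in> carrier R" using a by (simp add: b_def)
    have ba: "b \<otimes> a \<in> P" using Suc k by (simp add: b_def rng_pow_Suc)
    have "sandwich_pow b y n \<in> P" if y: "y \<in> I" for y
    proof -
      have cy: "y \<in> carrier R" using ID y by blast
      \<comment> \<open>\<open>y \<otimes> b\<close> lies in \<open>I\<close>, so the coset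
        hypothesis applies to \<open>?t\<close>; moreover \<open>b ?t = b a + b y b\<close> with
        \<open>b a\<close> in \<open>P\<close>.\<close>
      let ?t = "a \<oplus> y \<otimes> b"
      have ct: "?t \<in> carrier R" using a b cy by auto
      have sba: "sandwich_pow b y j \<otimes> a \<in> P" for j
      proof (cases j)
        case (Suc j)
        have "sandwich_pow b y (Suc j) \<otimes> a = (sandwich_pow b y j \<otimes> y) \<otimes> (b \<otimes> a)"
          using a b cy by (simp add: m_assoc)
        then show ?thesis using PD ba b cy Suc by simp
      qed (simp add: ba)
      have "\<exists>p\<in>P. b \<otimes> rng_pow R ?t n = sandwich_pow b y n \<oplus> p"
        using n
      proof (induction n rule: dec_induct)
        case base
        have "b \<otimes> rng_pow R ?t 1 = sandwich_pow b y 1 \<oplus> b \<otimes> a"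
          using a b cy by (simp add: r_distr a_comm m_assoc)
        then show ?case using ba by blast
      next
        case (step j)
        then obtain p where p: "p \<in> P" "b \<otimes> rng_pow R ?t j = sandwich_pow b y j \<oplus> p" by blast
        have cp: "p \<in> carrier R" using PD p by blast
        have "b \<otimes> rng_pow R ?t (Suc j) = (b \<otimes> rng_pow R ?t j) \<otimes> ?t"
          using step ct b by (simp add: rng_pow_Suc m_assoc)
        also have "\<dots> = sandwich_pow b y (Suc j) \<oplus> (sandwich_pow b y j \<otimes> a \<oplus> p \<otimes> ?t)"
          using a b cy cp by (simp add: p l_distr r_distr a_ac m_assoc)
        finally show ?case
          using PD sba[of j] p ct by (intro bexI[of _ "sandwich_pow b y j \<otimes> a \<oplus> p \<otimes> ?t"]) auto
      qed
      then obtain p where "p \<in> P" "b \<otimes> rng_pow R ?t n = sandwich_pow b y n \<oplus> p" by blast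
      moreover have "b \<otimes> rng_pow R ?t n \<in> P" using PD(4)[OF nil[OF ID(5)[OF y b]] b] .
      ultimately show ?thesis using rng_ideal_add_cancel[OF Pi] b cy by simp
    qed
    then show ?thesis unfolding b_def[symmetric] by (rule prime_sandwich_pow[OF P I nsub b])
  qed
  \<comment> \<open>The descent starts from the coset element with
    \<open>y = \<zero>\<close>.\<close>
  have "rng_pow R a n \<in> P" using nil[of \<zero>] ID a by simp
  with n have "rng_pow R a 1 \<in> P"
    by (induction n rule: dec_induct) (use step in auto)
  then show ?thesis by simp
qed

lemma pow_add_mod_ideal:
  assumes P: "rng_ideal P" and a: "a \<in> P" and y: "y \<in> carrier R" and n: "1 \<le> n"
  shows "\<exists>p\<in>P. rng_pow R (a \<oplus> y) n = rng_pow R y n \<oplus> p"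
  using n
proof (induction n rule: dec_induct)
  case base
  then show ?case using a y rng_idealD(1)[OF P] by (auto simp: a_comm)
next
  case (step j)
  note PD = rng_idealD[OF P]
  from step obtain p where p: "p \<in> P" "rng_pow R (a \<oplus> y) j = rng_pow R y j \<oplus> p" by blast
  have c: "p \<in> carrier R" "a \<in> carrier R" using PD p a by auto
  have "rng_pow R (a \<oplus> y) (Suc j) = rng_pow R y (Suc j) \<oplus> (rng_pow R y j \<otimes> a \<oplus> p \<otimes> (a \<oplus> y))"
    using step p c y by (simp add: rng_pow_Suc l_distr r_distr a_ac)
  then show ?case
    using PD p a y c by (intro bexI[of _ "rng_pow R y j \<otimes> a \<oplus> p \<otimes> (a \<oplus> y)"]) auto
qed

text \<open>The argument yields no explicit exponent, since \<open>P\<close> is chosen to avoid the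
  powers of the one element \<open>y\<close>. A uniform exponent comes from applying this in a ring
  of sequences.\<close>

lemma coset_nil_imp_nil:
  assumes I: "rng_ideal I" and a: "a \<in> carrier R" and n: "1 \<le> n"
    and nil: "\<And>y. y \<in> I \<Longrightarrow> rng_pow R (a \<oplus> y) n = \<zero>" and y: "y \<in> I"
  shows "\<exists>m\<ge>1. rng_pow R y m = \<zero>"
proof (rule ccontr)
  assume no: "\<not> ?thesis"
  have cy: "y \<in> carrier R" using rng_idealD[OF I] y by blast
  obtain P where P: "rng_prime P" and av: "\<And>n. 1 \<le> n \<Longrightarrow> rng_pow R y n \<notin> P"
    by (rule rng_prime_exists[OF cy]) (use no in auto)
  have Pi: "rng_ideal P" using P by (simp add: rng_prime_def)
  note PD = rng_idealD[OF Pi]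
  have "y \<notin> P" using av[of 1] by simp
  \<comment> \<open>\<open>y\<close> itself witnesses that \<open>I\<close> is not contained in
    \<open>P\<close>.\<close>
  then have "a \<in> P" using prime_coset_nil[OF P I _ a n] nil PD y by auto
  then obtain p where "p \<in> P" "rng_pow R (a \<oplus> y) n = rng_pow R y n \<oplus> p"
    using pow_add_mod_ideal[OF Pi _ cy n] by blast
  then have "rng_pow R y n \<in> P"
    using nil[OF y] PD rng_ideal_add_cancel[OF Pi, of "rng_pow R y n" p] cy by simp
  then show False using av n by blast
qed

end

section \<open>From pointwise to uniform exponents\<close>

text \<open>The countable power of \<open>R\<close>: a sequence is nilpotent exactly when one
  exponent kills all its terms.\<close>

definition sequence_rng :: "('a, 'm) ring_scheme \<Rightarrow> (nat \<Rightarrow> 'a) ring"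
  where "sequence_rng R =
    \<lparr>carrier = {f. \<forall>k. f k \<in> carrier R}, mult = (\<lambda>f g k. f k \<otimes>\<^bsub>R\<^esub> g k), one = (\<lambda>k. \<one>\<^bsub>R\<^esub>),
     zero = (\<lambda>k. \<zero>\<^bsub>R\<^esub>), add = (\<lambda>f g k. f k \<oplus>\<^bsub>R\<^esub> g k)\<rparr>"

context rng
begin

lemma rng_sequence_rng: "rng (sequence_rng R)"
proof -
  have "abelian_group (sequence_rng R)"
  proof (rule abelian_groupI)
    fix f assume "f \<in> carrier (sequence_rng R)"
    then show "\<exists>g\<in>carrier (sequence_rng R). g \<oplus>\<^bsub>sequence_rng R\<^esub> f = \<zero>\<^bsub>sequence_rng R\<^esub>"
      by (intro bexI[of _ "\<lambda>k. \<ominus> f k"]) (auto simp: sequence_rng_def l_neg)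
  qed (auto simp: sequence_rng_def a_ac)
  then show ?thesis
    by (intro rng.intro rng_axioms.intro) (auto simp: sequence_rng_def m_assoc l_distr r_distr)
qed

lemma sequence_rng_pow: "rng_pow (sequence_rng R) f n k = rng_pow R (f k) n"
proof -
  have "((\<lambda>y. y \<otimes>\<^bsub>sequence_rng R\<^esub> f) ^^ m) f k = ((\<lambda>y. y \<otimes> f k) ^^ m) (f k)" for m
    by (induction m) (auto simp: sequence_rng_def)
  then show ?thesis by (simp add: rng_pow_def)
qed

text \<open>The hypotheses pass, with the same \<open>n\<close>, to the constant sequence
  \<open>a\<close> and the ideal of sequences in \<open>I\<close>. If no exponent served all of
  \<open>I\<close>, a sequence whose term \<open>f m\<close> survives the exponent \<open>m\<close>
  would not be nilpotent.\<close>

lemma coset_nil_imp_bounded_nil: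
  assumes I: "rng_ideal I" and a: "a \<in> carrier R" and n: "1 \<le> n"
    and nil: "\<And>y. y \<in> I \<Longrightarrow> rng_pow R (a \<oplus> y) n = \<zero>"
  shows "\<exists>m\<ge>1. \<forall>y\<in>I. rng_pow R y m = \<zero>"
proof (rule ccontr)
  assume "\<not> ?thesis"
  then have "\<forall>m. \<exists>y\<in>I. 1 \<le> m \<longrightarrow> rng_pow R y m \<noteq> \<zero>" using rng_idealD(2)[OF I] by blast
  then obtain f where f: "\<And>m. f m \<in> I" "\<And>m. 1 \<le> m \<Longrightarrow> rng_pow R (f m) m \<noteq> \<zero>" by metis
  let ?K = "sequence_rng R" and ?I = "{g :: nat \<Rightarrow> 'a. \<forall>k. g k \<in> I}"
  note K = rng_sequence_rng
  have IR: "\<And>y. y \<in> I \<Longrightarrow> y \<in> carrier R" using rng_idealD(1)[OF I] by blast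
  have minus: "\<ominus>\<^bsub>?K\<^esub> g = (\<lambda>k. \<ominus> g k)" if "g \<in> ?I" for g
    by (rule abelian_group.minus_equality[OF rng.axioms(1)[OF K]])
       (use that IR in \<open>auto simp: sequence_rng_def l_neg\<close>)
  have "rng.rng_ideal ?K ?I"
    unfolding rng.rng_ideal_def[OF K]
  proof (intro conjI ballI)
    fix g assume g: "g \<in> ?I"
    show "\<ominus>\<^bsub>?K\<^esub> g \<in> ?I" using g I unfolding minus[OF g] by (simp add: rng_ideal_def)
  qed (use IR rng_idealD[OF I] in \<open>simp_all add: sequence_rng_def subset_iff\<close>)
  moreover have "(\<lambda>k. a) \<in> carrier ?K" using a by (simp add: sequence_rng_def)
  moreover have "rng_pow ?K ((\<lambda>k. a) \<oplus>\<^bsub>?K\<^esub> g) n = \<zero>\<^bsub>?K\<^esub>" if "g \<in> ?I" for g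
    by (rule ext, subst sequence_rng_pow) (use that nil in \<open>simp add: sequence_rng_def\<close>)
  moreover have "f \<in> ?I" using f(1) by simp
  ultimately obtain m where "1 \<le> m" "rng_pow ?K f m = \<zero>\<^bsub>?K\<^esub>"
    using rng.coset_nil_imp_nil[OF K _ _ n] by blast
  then have "rng_pow R (f m) m = \<zero>"
    using fun_cong[of "rng_pow ?K f m" "\<zero>\<^bsub>?K\<^esub>" m] unfolding sequence_rng_pow by (simp add: sequence_rng_def)
  then show False using f(2) \<open>1 \<le> m\<close> by blast
qed

end

subsection \<open>The Jacobson radical\<close>

lemma rng_pow_carrier_update [simp]: "rng_pow (R\<lparr>carrier := J\<rparr>) = rng_pow R"
  by (simp add: rng_pow_def fun_eq_iff)

context rng
begin

section \<open>Subrings, and nilpotence in the radical\<close>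

lemma subrngD:
  assumes "subrng J R"
  shows "x \<in> J \<Longrightarrow> x \<in> carrier R" "\<zero> \<in> J" "x \<in> J \<Longrightarrow> \<ominus> x \<in> J"
    "x \<in> J \<Longrightarrow> y \<in> J \<Longrightarrow> x \<oplus> y \<in> J" "x \<in> J \<Longrightarrow> y \<in> J \<Longrightarrow> x \<otimes> y \<in> J"
proof -
  have J: "subgroup J (add_monoid R)" using assms by (simp add: subrng_def)
  show "x \<in> J \<Longrightarrow> x \<in> carrier R" using subgroup.subset[OF J] by auto
  show "\<zero> \<in> J" using subgroup.one_closed[OF J] by simp
  show "x \<in> J \<Longrightarrow> \<ominus> x \<in> J" using subgroup.m_inv_closed[OF J] by (simp add: a_inv_def)
  show "x \<in> J \<Longrightarrow> y \<in> J \<Longrightarrow> x \<oplus> y \<in> J" using subgroup.m_closed[OF J] by simp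
  show "x \<in> J \<Longrightarrow> y \<in> J \<Longrightarrow> x \<otimes> y \<in> J" using assms by (simp add: subrng_def)
qed

lemma subrngI:
  assumes "J \<subseteq> carrier R" "\<zero> \<in> J" "\<And>x. x \<in> J \<Longrightarrow> \<ominus> x \<in> J"
    and "\<And>x y. x \<in> J \<Longrightarrow> y \<in> J \<Longrightarrow> x \<oplus> y \<in> J" "\<And>x y. x \<in> J \<Longrightarrow> y \<in> J \<Longrightarrow> x \<otimes> y \<in> J"
  shows "subrng J R"
  unfolding subrng_def
  by (intro conjI ballI subgroup.intro) (use assms in \<open>simp_all flip: a_inv_def\<close>)

lemma subrng_imp_rng:
  assumes "subrng J R" shows "rng (R\<lparr>carrier := J\<rparr>)"
proof -
  note J = subrngD[OF assms]
  have "abelian_group (R\<lparr>carrier := J\<rparr>)"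
  proof (rule abelian_groupI)
    fix x assume "x \<in> carrier (R\<lparr>carrier := J\<rparr>)"
    then show "\<exists>y\<in>carrier (R\<lparr>carrier := J\<rparr>). y \<oplus>\<^bsub>R\<lparr>carrier := J\<rparr>\<^esub> x = \<zero>\<^bsub>R\<lparr>carrier := J\<rparr>\<^esub>"
      using J by (intro bexI[of _ "\<ominus> x"]) (auto simp: l_neg)
  qed (use J in \<open>auto simp: a_ac\<close>)
  then show ?thesis
    by (intro rng.intro rng_axioms.intro) (use J in \<open>auto simp: m_assoc l_distr r_distr\<close>)
qed

lemma subrng_carrier: "subrng (carrier R) R"
  by (rule subrngI) auto

lemma subrng_pow_closed:
  assumes "subrng J R" "x \<in> J" shows "rng_pow R x n \<in> J"
  using rng.rng_pow_closed[OF subrng_imp_rng[OF assms(1)], of x n] assms(2) by simp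

lemma rng_pow_in_generated_subrng:
  assumes "x \<in> carrier R" "1 \<le> n" shows "rng_pow R x n \<in> generated_subrng R x"
  using assms(2)
proof (induction n rule: dec_induct)
  case base
  then show ?case by (auto simp: generated_subrng_def)
next
  case (step n)
  then show ?case by (auto simp: generated_subrng_def subrng_def rng_pow_Suc)
qed

text \<open>Some power of \<open>x\<close> is an idempotent \<open>e\<close>, and quasi-regularity of \<open>- e\<close> forces \<open>e = 0\<close>.\<close>

lemma jacobson_radical_nil:
  assumes wlf: "weakly_locally_finite R" and x: "x \<in> jacobson_radical R"
  shows "\<exists>n\<ge>1. rng_pow R x n = \<zero>"
proof -
  have cx: "x \<in> carrier R" using x by (simp add: jacobson_radical_def)
  have "range (\<lambda>n. rng_pow R x (Suc n)) \<subseteq> generated_subrng R x"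
    using rng_pow_in_generated_subrng[OF cx] by (intro image_subsetI) simp
  moreover have "finite (generated_subrng R x)" using wlf cx by (simp add: weakly_locally_finite_def)
  ultimately have "finite (range (\<lambda>n. rng_pow R x (Suc n)))" by (rule finite_subset)
  then have "\<not> inj (\<lambda>n. rng_pow R x (Suc n))" using finite_imageD infinite_UNIV_nat by blast
  then obtain i j where "i < j" "rng_pow R x (Suc i) = rng_pow R x (Suc j)"
    unfolding inj_def by (metis linorder_neqE_nat)
  then obtain i p where i: "1 \<le> i" and p: "1 \<le> p" and eq: "rng_pow R x (i + p) = rng_pow R x i"
    by (intro that[of "Suc i" "j - i"]) auto
  have shift: "rng_pow R x (k + p) = rng_pow R x k" if "i \<le> k" for k
    using that
  proof (induction k rule: dec_induct)
    case (step k)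
    then show ?case using i by (simp add: rng_pow_Suc)
  qed (rule eq)
  have shifts: "rng_pow R x (k + t * p) = rng_pow R x k" if "i \<le> k" for k t
  proof (induction t)
    case (Suc t)
    have "rng_pow R x (k + t * p + p) = rng_pow R x k" using shift[of "k + t * p"] that Suc by simp
    then show ?case by (simp add: ac_simps)
  qed simp
  \<comment> \<open>A multiple of the period \<open>p\<close> that is at least \<open>i\<close>, so
    that doubling the exponent changes nothing. The factor 2 ensures \<open>k - 1 \<ge> 1\<close>,
    so \<open>x^(k-1)\<close> is a genuine power.\<close>
  define k where "k = 2 * i * p"
  have k: "i \<le> k" "2 \<le> k" using i p mult_le_mono[of 2 2 1 "i * p"] by (auto simp: k_def)
  define e where "e = rng_pow R x k"
  have ce: "e \<in> carrier R" using cx by (simp add: e_def)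
  have ee: "e \<otimes> e = e"
    using shifts[OF k(1), of "2 * i"] k i cx by (simp add: e_def rng_pow_add) (simp add: k_def)
  define y where "y = \<ominus> rng_pow R x (k - 1)"
  have cy: "y \<in> carrier R" using cx by (simp add: y_def)
  have "rng_pow R x (k - 1) \<otimes> x = e"
    using k rng_pow_Suc[of "k - 1" x] by (simp add: e_def)
  then have yx: "y \<otimes> x = \<ominus> e" using cx by (simp add: y_def rng_l_minus)
  obtain z where z: "z \<in> carrier R" "y \<otimes> x \<oplus> z \<oplus> z \<otimes> y \<otimes> x = \<zero>"
    using x cy unfolding jacobson_radical_def by blast
  \<comment> \<open>Multiplying the quasi-regularity equation by \<open>e\<close> on the right
    cancels \<open>z e\<close> and leaves \<open>- e\<close>.\<close>
  have "(\<ominus> e \<oplus> z \<oplus> \<ominus> (z \<otimes> e)) \<otimes> e = \<zero>"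
    using z cx cy ce by (simp add: m_assoc yx rng_r_minus)
  then have "\<ominus> e = \<zero>"
    using z ce by (simp add: l_distr rng_l_minus m_assoc ee a_assoc r_neg)
  moreover have "\<ominus> \<zero> = \<zero>" by (rule minus_equality) auto
  ultimately have "e = \<zero>" using minus_minus[OF ce] by argo
  then show ?thesis using k by (intro exI[of _ k]) (simp add: e_def)
qed

lemma jacobson_radical_subrng: "subrng (jacobson_radical R) R"
proof -
  let ?J = "jacobson_radical R"
  have JI: "x \<in> ?J" if "x \<in> carrier R" "\<And>y. y \<in> carrier R \<Longrightarrow>
      \<exists>z\<in>carrier R. y \<otimes> x \<oplus> z \<oplus> z \<otimes> (y \<otimes> x) = \<zero>" for x
    unfolding jacobson_radical_def using that by (auto simp: m_assoc)
  have JD: "\<exists>z\<in>carrier R. y \<otimes> x \<oplus> z \<oplus> z \<otimes> (y \<otimes> x) = \<zero>" if "x \<in> ?J" "y \<in> carrier R" for x y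
    using that unfolding jacobson_radical_def by (auto simp: m_assoc)
  have JR: "\<And>x. x \<in> ?J \<Longrightarrow> x \<in> carrier R" by (simp add: jacobson_radical_def)
  have mult: "r \<otimes> x \<in> ?J" if x: "x \<in> ?J" and r: "r \<in> carrier R" for x r
  proof (rule JI)
    fix y assume "y \<in> carrier R"
    then show "\<exists>z\<in>carrier R. y \<otimes> (r \<otimes> x) \<oplus> z \<oplus> z \<otimes> (y \<otimes> (r \<otimes> x)) = \<zero>"
      using JD[OF x, of "y \<otimes> r"] JR[OF x] r by (simp add: m_assoc)
  qed (use JR x r in auto)
  have "x1 \<oplus> x2 \<in> ?J" if x: "x1 \<in> ?J" "x2 \<in> ?J" for x1 x2
  proof (rule JI)
    fix y assume y: "y \<in> carrier R"
    obtain z where z: "z \<in> carrier R" "y \<otimes> x1 \<oplus> z \<oplus> z \<otimes> (y \<otimes> x1) = \<zero>" using JD x y by blast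
    \<comment> \<open>\<open>?q\<close> is \<open>(1 + z) y x2\<close>. Since
      \<open>(1 + z) (1 + y x1) = 1\<close>, one gets
      \<open>(1 + z) (1 + y (x1 + x2)) = 1 + ?q\<close>, and \<open>1 + w\<close> is a left inverse
      of this.\<close>
    let ?q = "(y \<oplus> z \<otimes> y) \<otimes> x2"
    obtain w where w: "w \<in> carrier R" "?q \<oplus> w \<oplus> w \<otimes> ?q = \<zero>"
      using JD[OF x(2), of "y \<oplus> z \<otimes> y"] y z by auto
    have c: "x1 \<in> carrier R" "x2 \<in> carrier R" using x JR by auto
    text \<open>The witness is \<open>(1 + w) (1 + z) - 1\<close>.\<close>
    have "y \<otimes> (x1 \<oplus> x2) \<oplus> (w \<oplus> z \<oplus> w \<otimes> z) \<oplus> (w \<oplus> z \<oplus> w \<otimes> z) \<otimes> (y \<otimes> (x1 \<oplus> x2)) =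
        (y \<otimes> x1 \<oplus> z \<oplus> z \<otimes> (y \<otimes> x1)) \<oplus> w \<otimes> (y \<otimes> x1 \<oplus> z \<oplus> z \<otimes> (y \<otimes> x1)) \<oplus> (?q \<oplus> w \<oplus> w \<otimes> ?q)"
      using c y z(1) w(1) by (simp add: l_distr r_distr m_assoc a_ac)
    also have "\<dots> = \<zero>" unfolding z(2) w(2) using w by simp
    finally show "\<exists>z\<in>carrier R. y \<otimes> (x1 \<oplus> x2) \<oplus> z \<oplus> z \<otimes> (y \<otimes> (x1 \<oplus> x2)) = \<zero>"
      using w z by (intro bexI[of _ "w \<oplus> z \<oplus> w \<otimes> z"]) auto
  qed (use JR x in auto)
  moreover have "\<ominus> x \<in> ?J" if x: "x \<in> ?J" for x
  proof (rule JI)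
    fix y assume "y \<in> carrier R"
    then show "\<exists>z\<in>carrier R. y \<otimes> (\<ominus> x) \<oplus> z \<oplus> z \<otimes> (y \<otimes> (\<ominus> x)) = \<zero>"
      using JD[OF x, of "\<ominus> y"] JR[OF x] by (simp add: rng_l_minus rng_r_minus)
  qed (use JR x in auto)
  moreover have "\<zero> \<in> ?J" by (rule JI) (auto intro!: bexI[of _ \<zero>])
  ultimately show ?thesis using mult JR by (intro subrngI) auto
qed

end

subsection \<open>Profinite rings\<close>

text \<open>
  A profinite ring seen through its projections \<open>c i\<close> to finite quotients. The additive and
  multiplicative structure of the quotients is encoded by the kernels of the \<open>c i\<close> being
  congruences, and compactness by the finite intersection property for the sets \<open>{x. c i x \<in> A}\<close>.
\<close>

locale profinite_coordinates = rng R for R (structure) +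
  fixes I :: "'i set" and c :: "'i \<Rightarrow> 'a \<Rightarrow> 'c"
  assumes I_nonempty: "I \<noteq> {}"
    and c_add: "\<lbrakk>i \<in> I; x \<in> carrier R; x' \<in> carrier R; y \<in> carrier R; y' \<in> carrier R;
      c i x = c i x'; c i y = c i y'\<rbrakk> \<Longrightarrow> c i (x \<oplus> y) = c i (x' \<oplus> y')"
    and c_mult: "\<lbrakk>i \<in> I; x \<in> carrier R; x' \<in> carrier R; y \<in> carrier R; y' \<in> carrier R;
      c i x = c i x'; c i y = c i y'\<rbrakk> \<Longrightarrow> c i (x \<otimes> y) = c i (x' \<otimes> y')"
    and c_finite: "i \<in> I \<Longrightarrow> finite (c i ` carrier R)"
    and c_separates: "\<lbrakk>x \<in> carrier R; y \<in> carrier R; \<And>i. i \<in> I \<Longrightarrow> c i x = c i y\<rbrakk> \<Longrightarrow> x = y"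
    and c_directed: "\<lbrakk>i \<in> I; j \<in> I\<rbrakk> \<Longrightarrow> \<exists>k\<in>I. \<forall>x\<in>carrier R. \<forall>y\<in>carrier R.
      c k x = c k y \<longrightarrow> c i x = c i y \<and> c j x = c j y"
    and c_compact: "\<lbrakk>\<C> \<subseteq> I \<times> UNIV;
      \<And>F. finite F \<Longrightarrow> F \<subseteq> \<C> \<Longrightarrow> \<exists>x\<in>carrier R. \<forall>(i, A)\<in>F. c i x \<in> A\<rbrakk>
      \<Longrightarrow> \<exists>x\<in>carrier R. \<forall>(i, A)\<in>\<C>. c i x \<in> A"
begin

lemma c_pow:
  assumes "i \<in> I" "x \<in> carrier R" "y \<in> carrier R" "c i x = c i y" "1 \<le> n"
  shows "c i (rng_pow R x n) = c i (rng_pow R y n)"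
  using assms(5)
  by (induction n rule: dec_induct) (use assms in \<open>auto simp: rng_pow_Suc intro: c_mult\<close>)

lemma c_minus:
  assumes "i \<in> I" "x \<in> carrier R" "c i x = c i \<zero>"
  shows "c i (\<ominus> x) = c i \<zero>"
  using c_add[of i "\<ominus> x" "\<ominus> x" \<zero> x] assms by (simp add: l_neg)

text \<open>Refinement of congruences takes the place of the order on the index set, which the
  coordinates do not record.\<close>

definition finer :: "'i \<Rightarrow> 'i \<Rightarrow> bool"
  where "finer k i \<longleftrightarrow> (\<forall>x\<in>carrier R. \<forall>y\<in>carrier R. c k x = c k y \<longrightarrow> c i x = c i y)"

lemma finerD:
  "finer k i \<Longrightarrow> x \<in> carrier R \<Longrightarrow> y \<in> carrier R \<Longrightarrow> c k x = c k y \<Longrightarrow> c i x = c i y"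
  unfolding finer_def by blast

lemma finer_refl: "finer k k"
  by (simp add: finer_def)

lemma finer_trans: "finer l k \<Longrightarrow> finer k i \<Longrightarrow> finer l i"
  unfolding finer_def by blast

lemma finer_pair:
  assumes "i \<in> I" "j \<in> I"
  obtains k where "k \<in> I" "finer k i" "finer k j"
proof -
  obtain k where "k \<in> I" "\<forall>x\<in>carrier R. \<forall>y\<in>carrier R.
      c k x = c k y \<longrightarrow> c i x = c i y \<and> c j x = c j y"
    using c_directed[OF assms] by (rule bexE)
  then show thesis by (intro that[of k]) (unfold finer_def, blast+)
qed

lemma finer_finite:
  assumes "finite F" "F \<subseteq> I"
  shows "\<exists>k\<in>I. \<forall>i\<in>F. finer k i"
  using assms
proof (induction F rule: finite_induct)
  case empty
  then show ?case using I_nonempty by auto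
next
  case (insert i F)
  then obtain k where k: "k \<in> I" "\<And>i. i \<in> F \<Longrightarrow> finer k i" by auto
  obtain l where l: "l \<in> I" "finer l k" "finer l i"
    using finer_pair[OF k(1)] insert.prems by auto
  then show ?case using k(2) finer_trans by blast
qed

section \<open>Closed subsets of a profinite ring\<close>

text \<open>These are the closed sets of the topology induced by the coordinates: by directedness,
  preimages under single coordinates form a base.\<close>

definition cylinder_closed :: "'a set \<Rightarrow> bool"
  where "cylinder_closed J \<longleftrightarrow>
    (\<exists>\<A>\<subseteq>I \<times> UNIV. J = {x \<in> carrier R. \<forall>(i, A)\<in>\<A>. c i x \<in> A})"

text \<open>For fixed \<open>y\<close>, the \<open>x\<close> admitting a solution \<open>z\<close>
  form the projection of a closed set along a compact factor. Concretely, solvability at every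
  coordinate gives solvability by compactness.\<close>

lemma jacobson_radical_cylinder_closed: "cylinder_closed (jacobson_radical R)"
proof -
  let ?g = "\<lambda>y x z. y \<otimes> x \<oplus> z \<oplus> z \<otimes> y \<otimes> x"
  \<comment> \<open>\<open>B y i\<close> collects the \<open>i\<close>-th coordinates of those
    \<open>x\<close> for which the equation is solvable at coordinate \<open>i\<close>.\<close>
  define B where "B y i = {c i x |x. x \<in> carrier R \<and> (\<exists>z\<in>carrier R. c i (?g y x z) = c i \<zero>)}" for y i
  define \<A> where "\<A> = {(i, B y i) |i y. i \<in> I \<and> y \<in> carrier R}"
  have g_cong: "c i (?g y x z) = c i (?g y x' z')"
    if "i \<in> I" "y \<in> carrier R" "x \<in> carrier R" "x' \<in> carrier R" "z \<in> carrier R" "z' \<in> carrier R"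
      "c i x = c i x'" "c i z = c i z'" for i y x x' z z'
    using that by (auto intro!: c_add c_mult)
  have "x \<in> jacobson_radical R" if x: "x \<in> carrier R" "\<forall>(i, A)\<in>\<A>. c i x \<in> A" for x
  proof -
    have "\<exists>z\<in>carrier R. ?g y x z = \<zero>" if y: "y \<in> carrier R" for y
    proof -
      define Z where "Z i = c i ` {z \<in> carrier R. c i (?g y x z) = c i \<zero>}" for i
      let ?C = "(\<lambda>i. (i, Z i)) ` I"
      have ex: "\<exists>z\<in>carrier R. c i (?g y x z) = c i \<zero>" if i: "i \<in> I" for i
      proof -
        have "c i x \<in> B y i" using x y i unfolding \<A>_def by blast
        then obtain x' z where z: "x' \<in> carrier R" "z \<in> carrier R" "c i x = c i x'"
          "c i (?g y x' z) = c i \<zero>" unfolding B_def by blast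
        then show ?thesis using g_cong[of i y x x' z z] x y i by (intro bexI[of _ z]) auto
      qed
      have "\<exists>z\<in>carrier R. \<forall>(i, A)\<in>?C. c i z \<in> A"
      proof (rule c_compact)
        fix F assume F: "finite F" "F \<subseteq> ?C"
        then obtain F' where F': "finite F'" "F' \<subseteq> I" "F = (\<lambda>i. (i, Z i)) ` F'"
          by (meson finite_subset_image)
        \<comment> \<open>A solution at one coordinate finer than finitely many others solves the
          equation at all of them.\<close>
        obtain k where k: "k \<in> I" "\<forall>i\<in>F'. finer k i"
          using finer_finite[OF F'(1,2)] by (rule bexE)
        obtain z where z: "z \<in> carrier R" "c k (?g y x z) = c k \<zero>" using ex k by blast
        have "c i z \<in> Z i" if "i \<in> F'" for i
          using finerD[OF k(2)[rule_format, OF that], of "?g y x z" \<zero>] z x y by (simp add: Z_def)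
        then show "\<exists>z\<in>carrier R. \<forall>(i, A)\<in>F. c i z \<in> A"
          using F'(3) z(1) by (intro bexI[of _ z]) auto
      qed auto
      then obtain z where z: "z \<in> carrier R" "\<And>i. i \<in> I \<Longrightarrow> c i z \<in> Z i" by auto
      \<comment> \<open>Membership in \<open>Z i\<close> only says that \<open>z\<close> agrees at
        \<open>i\<close> with some solution there; the congruence property transfers the equation to
        \<open>z\<close>.\<close>
      have "c i (?g y x z) = c i \<zero>" if i: "i \<in> I" for i
      proof -
        obtain z' where "z' \<in> carrier R" "c i (?g y x z') = c i \<zero>" "c i z = c i z'"
          using z(2)[OF i] by (auto simp: Z_def)
        then show ?thesis using g_cong[of i y x x z z'] x y z i by simp
      qed
      then have "?g y x z = \<zero>" using c_separates[of "?g y x z" \<zero>] x y z by simp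
      then show ?thesis using z by blast
    qed
    then show ?thesis using x by (simp add: jacobson_radical_def)
  qed
  moreover have "c i x \<in> A" if x: "x \<in> jacobson_radical R" and A: "(i, A) \<in> \<A>" for x i A
  proof -
    obtain y where y: "y \<in> carrier R" "A = B y i" using A by (auto simp: \<A>_def)
    have "x \<in> carrier R" using x by (auto simp: jacobson_radical_def)
    moreover obtain z where "z \<in> carrier R" "?g y x z = \<zero>"
      using x y by (auto simp: jacobson_radical_def)
    ultimately show ?thesis unfolding y(2) B_def
      by (intro CollectI exI[of _ x] conjI refl bexI[of _ z]) auto
  qed
  ultimately have "jacobson_radical R = {x \<in> carrier R. \<forall>(i, A)\<in>\<A>. c i x \<in> A}"
    by (fastforce simp: jacobson_radical_def)
  moreover have "\<A> \<subseteq> I \<times> UNIV" by (auto simp: \<A>_def)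
  ultimately show ?thesis unfolding cylinder_closed_def by blast
qed

text \<open>Compactness provides a limit in \<open>J\<close> of a coherent sequence: finitely many
  of the prescribed coordinates are met by a late term, which lies in every cylinder defining
  \<open>J\<close>.\<close>

lemma cylinder_closed_nested:
  assumes J: "cylinder_closed J"
    and a: "\<And>m::nat. a m \<in> J" and k: "\<And>m. k m \<in> I"
    and nested: "\<And>m M. m \<le> M \<Longrightarrow> c (k m) (a M) = c (k m) (a m)"
  shows "\<exists>x\<in>J. \<forall>m. c (k m) x = c (k m) (a m)"
proof -
  obtain \<A> where \<A>: "\<A> \<subseteq> I \<times> UNIV" "J = {x \<in> carrier R. \<forall>(i, A)\<in>\<A>. c i x \<in> A}"
    using J unfolding cylinder_closed_def by blast
  let ?p = "\<lambda>m. (k m, {c (k m) (a m)})"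
  have "\<exists>x\<in>carrier R. \<forall>(i, A)\<in>\<A> \<union> range ?p. c i x \<in> A"
  proof (rule c_compact)
    fix F assume F: "finite F" "F \<subseteq> \<A> \<union> range ?p"
    then have "finite (F \<inter> range ?p)" "F \<inter> range ?p \<subseteq> range ?p" by auto
    then obtain N where N: "finite N" "F \<inter> range ?p = ?p ` N" by (meson finite_subset_image)
    obtain M where M: "\<And>m. m \<in> N \<Longrightarrow> m \<le> M"
      using finite_nat_set_iff_bounded_le[THEN iffD1, OF N(1)] by blast
    have "c i (a M) \<in> A" if "(i, A) \<in> F" for i A
    proof (cases "(i, A) \<in> \<A>")
      case True
      then show ?thesis using a[of M] \<A>(2) by blast
    next
      case False
      then have "(i, A) \<in> F \<inter> range ?p" using that F(2) by auto
      then obtain m where "m \<in> N" "i = k m" "A = {c (k m) (a m)}" unfolding N(2) by auto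
      then show ?thesis using nested[OF M] by simp
    qed
    then show "\<exists>x\<in>carrier R. \<forall>(i, A)\<in>F. c i x \<in> A" using a[of M] \<A>(2) by blast
  qed (use \<A>(1) k in auto)
  then obtain x where x: "x \<in> carrier R" "\<forall>(i, A)\<in>\<A> \<union> range ?p. c i x \<in> A" by blast
  have "c (k m) x = c (k m) (a m)" for m using bspec[OF x(2) UnI2[OF rangeI[of ?p m]]] by simp
  then show ?thesis using x \<A>(2) by (intro bexI[of _ x]) auto
qed

text \<open>Baire category: the closed sets \<open>x^n = 0\<close> cover \<open>J\<close>, so one of
  them contains a fibre of some \<open>c i\<close> in \<open>J\<close>. Otherwise nested fibres
  avoid them one after another, and a limit of their centres is not nilpotent.\<close>

lemma nil_coset_exists:
  assumes J: "cylinder_closed J" and ne: "J \<noteq> {}"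
    and nil: "\<And>x. x \<in> J \<Longrightarrow> \<exists>n\<ge>1. rng_pow R x n = \<zero>"
  shows "\<exists>a\<in>J. \<exists>i\<in>I. \<exists>n\<ge>1. \<forall>y\<in>J. c i y = c i a \<longrightarrow> rng_pow R y n = \<zero>"
proof (rule ccontr)
  assume no: "\<not> ?thesis"
  have JR: "\<And>x. x \<in> J \<Longrightarrow> x \<in> carrier R" using J unfolding cylinder_closed_def by blast
  \<comment> \<open>\<open>(a, k)\<close> stands for the fibre of \<open>c k\<close> through
    \<open>a\<close>. Step \<open>m\<close> passes to a smaller fibre, on which coordinate
    \<open>k'\<close> shows that the power with exponent \<open>Suc m\<close> is nonzero.\<close>
  let ?P = "\<lambda>m (a, k). a \<in> J \<and> k \<in> I"
  let ?Q = "\<lambda>m (a, k) (a', k'). c k a' = c k a \<and>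
    c k' (rng_pow R a' (Suc m)) \<noteq> c k' \<zero> \<and> finer k' k"
  have "\<exists>f. \<forall>m. ?P m (f m) \<and> ?Q m (f m) (f (Suc m))"
  proof (rule dependent_nat_choice)
    show "\<exists>x. ?P 0 x" using ne I_nonempty by auto
  next
    fix x m assume "?P m x"
    then obtain a k where x: "x = (a, k)" "a \<in> J" "k \<in> I" by (cases x) auto
    then obtain a' where a': "a' \<in> J" "c k a' = c k a" "rng_pow R a' (Suc m) \<noteq> \<zero>"
      using no by (metis Suc_eq_plus1 le_add2)
    then obtain j where j: "j \<in> I" "c j (rng_pow R a' (Suc m)) \<noteq> c j \<zero>"
      using c_separates[of "rng_pow R a' (Suc m)" \<zero>] JR by auto
    obtain k' where k': "k' \<in> I" "finer k' k" "finer k' j" using finer_pair[OF x(3) j(1)] .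
    have "c k' (rng_pow R a' (Suc m)) \<noteq> c k' \<zero>"
      using finerD[OF k'(3), of "rng_pow R a' (Suc m)" \<zero>] j(2) JR[OF a'(1)] by auto
    then show "\<exists>y. ?P (Suc m) y \<and> ?Q m x y"
      using a' k' x by (intro exI[of _ "(a', k')"]) auto
  qed
  then obtain f where f': "\<forall>m. ?P m (f m) \<and> ?Q m (f m) (f (Suc m))" by (rule exE)
  then have f: "?P m (f m)" "?Q m (f m) (f (Suc m))" for m by (simp_all only: simp_thms)
  define a k where "a m = fst (f m)" and "k m = snd (f m)" for m
  have a: "\<And>m. a m \<in> J" and k: "\<And>m. k m \<in> I"
    using f(1) by (auto simp: a_def k_def split_beta)
  have agree: "c (k m) (a (Suc m)) = c (k m) (a m)"
    and neq: "c (k (Suc m)) (rng_pow R (a (Suc m)) (Suc m)) \<noteq> c (k (Suc m)) \<zero>"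
    and fin: "finer (k (Suc m)) (k m)" for m
    using f(2)[of m] by (auto simp: a_def k_def split_beta)
  have fin': "finer (k M) (k m)" if "m \<le> M" for m M
    using that by (induction M rule: dec_induct) (auto intro: fin finer_refl finer_trans)
  have nested: "c (k m) (a M) = c (k m) (a m)" if "m \<le> M" for m M
    using that
  proof (induction M rule: dec_induct)
    case (step M)
    have "c (k m) (a (Suc M)) = c (k m) (a M)"
      using finerD[OF fin'[OF step.hyps(1)] _ _ agree] a JR by blast
    then show ?case using step by simp
  qed simp
  have "\<exists>x\<in>J. \<forall>m. c (k m) x = c (k m) (a m)"
    by (rule cylinder_closed_nested[OF J a k]) (rule nested)
  then obtain x where x: "x \<in> J" "\<And>m. c (k m) x = c (k m) (a m)" by blast
  obtain n where n: "1 \<le> n" "rng_pow R x n = \<zero>" using nil x(1) by blast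
  \<comment> \<open>The fibre with index \<open>Suc n\<close> excludes the exponent
    \<open>Suc n\<close>, so \<open>x^n = 0\<close> is used in the form
    \<open>x^(n+1) = 0\<close>.\<close>
  have "c (k (Suc n)) (rng_pow R (a (Suc n)) (Suc n)) = c (k (Suc n)) (rng_pow R x (Suc n))"
    using x a k JR by (intro c_pow) auto
  also have "\<dots> = c (k (Suc n)) \<zero>"
    using n x(1) JR by (simp add: rng_pow_Suc)
  finally show False using neq by blast
qed

text \<open>Regard \<open>J\<close> as a ring and let \<open>N\<close> be the kernel of
  \<open>c i\<close> in it. A coset of \<open>N\<close> with bounded exponent bounds the exponents
  on \<open>N\<close>; as \<open>J / N\<close> is finite, one power maps \<open>J\<close> into
  \<open>N\<close>, and the two exponents multiply.\<close>

lemma cylinder_closed_nil_bounded: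
  assumes J: "cylinder_closed J" and sub: "subrng J R"
    and nil: "\<And>x. x \<in> J \<Longrightarrow> \<exists>n\<ge>1. rng_pow R x n = \<zero>"
  shows "\<exists>n\<ge>1. \<forall>x\<in>J. rng_pow R x n = \<zero>"
proof -
  let ?S = "R\<lparr>carrier := J\<rparr>"
  note S = subrng_imp_rng[OF sub] and SD = subrngD[OF sub]
  note JR = SD(1) and zJ = SD(2)
  have "\<exists>a\<in>J. \<exists>i\<in>I. \<exists>n\<ge>1. \<forall>y\<in>J. c i y = c i a \<longrightarrow> rng_pow R y n = \<zero>"
    by (rule nil_coset_exists[OF J _ nil]) (use zJ in auto)
  then obtain a i n where a: "a \<in> J" and i: "i \<in> I" and n: "1 \<le> n"
    and an: "\<forall>y\<in>J. c i y = c i a \<longrightarrow> rng_pow R y n = \<zero>"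
    by (elim bexE exE conjE)
  let ?N = "{y \<in> J. c i y = c i \<zero>}"
  have minus: "\<ominus>\<^bsub>?S\<^esub> x = \<ominus> x" if "x \<in> J" for x
    by (rule abelian_group.minus_equality[OF rng.axioms(1)[OF S]]) (use that SD in \<open>auto simp: l_neg\<close>)
  \<comment> \<open>This places the coset \<open>a + ?N\<close> inside the fibre of
    \<open>c i\<close> on which the exponent \<open>n\<close> works.\<close>
  have add: "c i (x \<oplus> y) = c i x" if "x \<in> J" "y \<in> ?N" for x y
    using c_add[of i x x y \<zero>] i that JR by auto
  have "rng.rng_ideal ?S ?N"
    unfolding rng.rng_ideal_def[OF S]
  proof (intro conjI ballI)
    fix x assume x: "x \<in> ?N"
    show "\<ominus>\<^bsub>?S\<^esub> x \<in> ?N"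
      using minus[of x] SD(3)[of x] x c_minus[OF i] JR by auto
    fix y assume y: "y \<in> ?N"
    show "x \<oplus>\<^bsub>?S\<^esub> y \<in> ?N" using add[of x y] x y SD(4)[of x y] by auto
  next
    fix x r assume x: "x \<in> ?N" and r: "r \<in> carrier ?S"
    show "r \<otimes>\<^bsub>?S\<^esub> x \<in> ?N"
      using SD(5)[of r x] c_mult[of i r r x \<zero>] x r i JR by auto
    show "x \<otimes>\<^bsub>?S\<^esub> r \<in> ?N"
      using SD(5)[of x r] c_mult[of i x \<zero> r r] x r i JR by auto
  qed (use zJ in auto)
  then have "\<exists>m\<ge>1. \<forall>y\<in>?N. rng_pow ?S y m = \<zero>\<^bsub>?S\<^esub>"
    by (rule rng.coset_nil_imp_bounded_nil[OF S, of _ a n]) (use a an add[OF a] SD(4)[OF a] n in auto)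
  then obtain m where m: "1 \<le> m" "\<And>y. y \<in> J \<Longrightarrow> c i y = c i \<zero> \<Longrightarrow> rng_pow R y m = \<zero>" by auto
  have "finite (c i ` J)" using c_finite[OF i] JR by (meson finite_subset image_mono subsetI)
  moreover obtain d where d: "\<And>x. x \<in> J \<Longrightarrow> 1 \<le> d x \<and> rng_pow R x (d x) = \<zero>" using nil by metis
  ultimately obtain X where X: "finite X" "X \<subseteq> J" "c i ` J = c i ` X"
    by (meson finite_subset_image order_refl)
  \<comment> \<open>The sum bounds every \<open>d x\<close>, and \<open>Suc\<close> makes
    \<open>D\<close> visibly positive. Each \<open>y\<close> shares its coordinate with some
    \<open>x\<close> in \<open>X\<close>, and \<open>x^D = 0\<close>.\<close>
  define D where "D = Suc (\<Sum>x\<in>X. d x)"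
  have D: "c i (rng_pow R y D) = c i \<zero>" if y: "y \<in> J" for y
  proof -
    obtain x where x: "x \<in> X" "c i y = c i x" using X(3) y by blast
    have "d x \<le> D" using member_le_sum[OF x(1), of d] X(1) by (simp add: D_def)
    then have "rng_pow R x D = \<zero>" using d x X(2) JR rng_pow_zero_mono by blast
    then show ?thesis using c_pow[of i y x D] i x X(2) y JR by (auto simp: D_def)
  qed
  have "rng_pow R y (D * m) = \<zero>" if y: "y \<in> J" for y
  proof -
    have "rng_pow R y D \<in> J" using subrng_pow_closed[OF sub y] .
    then have "rng_pow R (rng_pow R y D) m = \<zero>" using m D y by blast
    then show ?thesis using y JR m(1) by (simp add: rng_pow_mult D_def del: mult_Suc)
  qed
  moreover have "1 \<le> D * m" using m(1) by (simp add: D_def)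
  ultimately show ?thesis by blast
qed

lemma nil_rng_bounded:
  assumes "nil_rng R" shows "nil_of_finite_nilexponent R"
proof -
  \<comment> \<open>The empty family of cylinders describes the whole carrier.\<close>
  have "cylinder_closed (carrier R)" unfolding cylinder_closed_def by (intro exI[of _ "{}"]) auto
  then show ?thesis
    using cylinder_closed_nil_bounded[OF _ subrng_carrier] assms
    by (simp add: nil_rng_def nil_of_finite_nilexponent_def)
qed

lemma jacobson_radical_bounded:
  assumes "weakly_locally_finite R"
  shows "nil_of_finite_nilexponent (R\<lparr>carrier := jacobson_radical R\<rparr>)"
  using cylinder_closed_nil_bounded[OF jacobson_radical_cylinder_closed jacobson_radical_subrng]
    jacobson_radical_nil[OF assms]
  by (simp add: nil_of_finite_nilexponent_def)

end

section \<open>Compactness of inverse limits\<close>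

text \<open>The limit is cut out of a product of finite discrete spaces, compact by Tychonoff, by
  conditions that each equate two continuous maps into a Hausdorff space.\<close>

lemma (in inverse_system_of_finite_rngs) compact_inverse_limit_topology:
  shows "compact_space (inverse_limit_topology I r S \<phi>)"
    and "topspace (inverse_limit_topology I r S \<phi>) = carrier (inverse_limit I r S \<phi>)"
    and "i \<in> I \<Longrightarrow> closedin (inverse_limit_topology I r S \<phi>)
      {x \<in> carrier (inverse_limit I r S \<phi>). x i \<in> A}"
proof -
  let ?D = "\<lambda>i. discrete_topology (carrier (S i))"
  let ?X = "product_topology ?D I"
  let ?L = "carrier (inverse_limit I r S \<phi>)"
  have rI: "i \<in> I" "j \<in> I" if "(i, j) \<in> r" for i j
    using partial_order that by (auto simp: partial_order_on_def preorder_on_def)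
  have map: "\<phi> i j \<in> carrier (S j) \<rightarrow> carrier (S i)" if "(i, j) \<in> r" for i j
    using hom[OF that] by (auto simp: rng_hom_def hom_def)
  have L: "?L = topspace ?X \<inter> (\<Inter>(i, j)\<in>r. {x \<in> topspace ?X. \<phi> i j (x j) = x i})"
    by (auto simp: inverse_limit_def)
  have "closedin ?X {x \<in> topspace ?X. \<phi> i j (x j) = x i}" if ij: "(i, j) \<in> r" for i j
  proof (rule closedin_continuous_maps_eq[of "?D i"])
    have "continuous_map ?X (?D i) (\<phi> i j \<circ> (\<lambda>x. x j))"
      using rI[OF ij] map[OF ij]
      by (intro continuous_map_compose[of _ "?D j"] continuous_map_product_projection) auto
    then show "continuous_map ?X (?D i) (\<lambda>x. \<phi> i j (x j))" by (simp add: o_def)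
  qed (use rI[OF ij] in \<open>auto intro: continuous_map_product_projection\<close>)
  then have "closedin ?X ?L"
    \<comment> \<open>The split is there because an intersection over an empty \<open>r\<close>
      would be \<open>UNIV\<close>, which is not a closed subset of \<open>?X\<close> as
      such.\<close>
    unfolding L by (cases "r = {}")
      (auto intro!: closedin_Int closedin_Inter simp del: topspace_product_topology)
  moreover have "compact_space ?X"
    using finite by (simp add: compact_space_product_topology compact_space_discrete_topology)
  ultimately show "compact_space (inverse_limit_topology I r S \<phi>)"
    unfolding inverse_limit_topology_def
    by (intro compact_space_subtopology closedin_compact_space)
  show top: "topspace (inverse_limit_topology I r S \<phi>) = ?L"
    using L by (auto simp: inverse_limit_topology_def)
  show "closedin (inverse_limit_topology I r S \<phi>) {x \<in> ?L. x i \<in> A}" if "i \<in> I"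
  proof -
    have "continuous_map (inverse_limit_topology I r S \<phi>) (?D i) (\<lambda>x. x i)"
      unfolding inverse_limit_topology_def
      by (intro continuous_map_from_subtopology continuous_map_product_projection that)
    then have "closedin (inverse_limit_topology I r S \<phi>)
        {x \<in> topspace (inverse_limit_topology I r S \<phi>). x i \<in> A \<inter> carrier (S i)}"
      by (rule closedin_continuous_map_preimage) simp
    moreover have "{x \<in> ?L. x i \<in> A \<inter> carrier (S i)} = {x \<in> ?L. x i \<in> A}"
      using that by (auto simp: inverse_limit_def)
    ultimately show ?thesis by (simp add: top)
  qed
qed

text \<open>The coordinates are the components of \<open>h x\<close>; compactness is carried from
  the limit to \<open>R\<close> by the bijection \<open>h\<close>.\<close>

lemma profinite_rng_coordinates:
  assumes "profinite_rng TYPE('i) TYPE('b) (R :: ('a, 'm) ring_scheme) T"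
  obtains I :: "'i set" and c :: "'i \<Rightarrow> 'a \<Rightarrow> 'b" where "profinite_coordinates R I c"
proof -
  obtain I :: "'i set" and r and S :: "'i \<Rightarrow> 'b ring" and \<phi> h
    where R: "rng R" and T: "topspace T = carrier R"
      and sys: "inverse_system_of_finite_rngs I r S \<phi>"
      and h: "h \<in> rng_hom R (inverse_limit I r S \<phi>)"
      and homeo: "homeomorphic_map T (inverse_limit_topology I r S \<phi>) h"
    using assms unfolding profinite_rng_def by blast
  note sys_rules = inverse_system_of_finite_rngs.nonempty[OF sys]
    inverse_system_of_finite_rngs.finite[OF sys] inverse_system_of_finite_rngs.directed[OF sys]
  note topology = inverse_system_of_finite_rngs.compact_inverse_limit_topology[OF sys]
  let ?L = "carrier (inverse_limit I r S \<phi>)" and ?T = "inverse_limit_topology I r S \<phi>"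
  have surj: "h ` carrier R = ?L"
    using homeomorphic_imp_surjective_map[OF homeo] T topology(2) by simp
  have inj: "inj_on h (carrier R)" using homeomorphic_imp_injective_map[OF homeo] T by simp
  have LE: "x i \<in> carrier (S i)" if "x \<in> ?L" "i \<in> I" for x i
    using that by (auto simp: inverse_limit_def)
  have hL: "\<And>x. x \<in> carrier R \<Longrightarrow> h x \<in> ?L" using surj by blast
  have hadd: "h (x \<oplus>\<^bsub>R\<^esub> y) i = h x i \<oplus>\<^bsub>S i\<^esub> h y i"
    and hmult: "h (x \<otimes>\<^bsub>R\<^esub> y) i = h x i \<otimes>\<^bsub>S i\<^esub> h y i"
    if "x \<in> carrier R" "y \<in> carrier R" "i \<in> I" for x y i
    using h that by (auto simp: rng_hom_def hom_def inverse_limit_def)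
  have "profinite_coordinates R I (\<lambda>i x. h x i)"
  proof (intro profinite_coordinates.intro profinite_coordinates_axioms.intro)
    show "I \<noteq> {}" by (rule sys_rules)
    fix i assume i: "i \<in> I"
    have "(\<lambda>x. h x i) ` carrier R \<subseteq> carrier (S i)" using hL LE i by blast
    then show "finite ((\<lambda>x. h x i) ` carrier R)" using sys_rules(2)[OF i] finite_subset by blast
    fix j assume j: "j \<in> I"
    \<comment> \<open>Coordinates \<open>i\<close> and \<open>j\<close> are images of coordinate
      \<open>k\<close> under the transition maps.\<close>
    obtain k where k: "k \<in> I" "(i, k) \<in> r" "(j, k) \<in> r" using sys_rules(3)[OF i j] by blast
    have "h x i = \<phi> i k (h x k)" "h x j = \<phi> j k (h x k)" if "x \<in> carrier R" for x
      using hL[OF that] k by (auto simp: inverse_limit_def)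
    then show "\<exists>k\<in>I. \<forall>x\<in>carrier R. \<forall>y\<in>carrier R. h x k = h y k \<longrightarrow> h x i = h y i \<and> h x j = h y j"
      using k(1) by (intro bexI[of _ k]) auto
  next
    fix x y assume xy: "x \<in> carrier R" "y \<in> carrier R" and eq: "\<And>i. i \<in> I \<Longrightarrow> h x i = h y i"
    have "h x = h y"
      by (rule PiE_ext[of _ I "\<lambda>i. carrier (S i)", OF _ _ eq])
         (use hL[OF xy(1)] hL[OF xy(2)] in \<open>auto simp: inverse_limit_def\<close>)
    then show "x = y" using inj xy by (auto dest: inj_onD)
  next
    fix \<C> :: "('i \<times> 'b set) set"
    assume \<C>: "\<C> \<subseteq> I \<times> UNIV"
      and fip: "\<And>F. finite F \<Longrightarrow> F \<subseteq> \<C> \<Longrightarrow> \<exists>x\<in>carrier R. \<forall>(i, A)\<in>F. h x i \<in> A"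
    let ?Z = "\<lambda>(i, A). {x \<in> ?L. x i \<in> A}"
    show "\<exists>x\<in>carrier R. \<forall>(i, A)\<in>\<C>. h x i \<in> A"
    \<comment> \<open>For empty \<open>\<C>\<close> the intersection below would be
      \<open>UNIV\<close> rather than \<open>?L\<close>.\<close>
    proof (cases "\<C> = {}")
      case True
      then show ?thesis using fip[of "{}"] by blast
    next
      case False
      have "\<Inter>(?Z ` \<C>) \<noteq> {}"
      proof (rule compact_space_fip[THEN iffD1, rule_format, of ?T])
        show "compact_space ?T" by (rule topology(1))
        have "\<Inter>\<F> \<noteq> {}" if \<F>: "finite \<F>" "\<F> \<subseteq> ?Z ` \<C>" for \<F>
        proof -
          obtain F where F: "finite F" "F \<subseteq> \<C>" "\<F> = ?Z ` F"
            using finite_subset_image[OF \<F>] by blast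
          then obtain x where "x \<in> carrier R" "\<forall>(i, A)\<in>F. h x i \<in> A" using fip by blast
          then have "h x \<in> \<Inter>\<F>" using F(3) hL by auto
          then show ?thesis by blast
        qed
        moreover have "closedin ?T (?Z p)" if "p \<in> \<C>" for p
          using topology(3)[of "fst p" "snd p"] \<C> that by (auto simp: split_beta)
        ultimately show "(\<forall>C\<in>?Z ` \<C>. closedin ?T C) \<and>
            (\<forall>\<F>. finite \<F> \<and> \<F> \<subseteq> ?Z ` \<C> \<longrightarrow> \<Inter>\<F> \<noteq> {})"
          by blast
      qed
      then obtain l where "l \<in> \<Inter>(?Z ` \<C>)" by blast
      then have l: "l \<in> ?L" "\<forall>(i, A)\<in>\<C>. l i \<in> A" using False by auto
      then obtain x where "x \<in> carrier R" "l = h x" using surj by (metis imageE)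
      then show ?thesis using l(2) by blast
    qed
  qed (use R in \<open>auto simp: hadd hmult\<close>)
  then show thesis by (rule that)
qed

theorem theorem1p4:
  fixes R :: "('a, 'm) ring_scheme" and T :: "'a topology"
  assumes "profinite_rng TYPE('i) TYPE('b) R T"
  shows "(weakly_locally_finite R \<longrightarrow>
            nil_of_finite_nilexponent (R\<lparr>carrier := jacobson_radical R\<rparr>)) \<and>
         (nil_rng R \<longrightarrow> nil_of_finite_nilexponent R)"
proof -
  obtain I :: "'i set" and c :: "'i \<Rightarrow> 'a \<Rightarrow> 'b" where "profinite_coordinates R I c"
    using profinite_rng_coordinates[OF assms] .
  then show ?thesis
    using profinite_coordinates.jacobson_radical_bounded profinite_coordinates.nil_rng_bounded by blast
qed

end
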